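(* Let $(Z,d)$ be a finite ultrametric space. Then for all nonempty subsets $X,Y\subseteq Z$ the Hausdorff distance is given by $$d_H(X,Y)=\begin{cases}0, & X=Y,\\ \max\limits_{B\in\mathfrak{B}_{XY}}\operatorname{diam}B, & \text{otherwise.}\end{cases}$$
   Context: An ultrametric space $(Z,d)$ is a metric space with $d(x,y)\le\max\{d(x,z),d(z,y)\}$ for all $x,y,z$. Hausdorff distance: for $x\in Z$ and nonempty $A\subseteq Z$ let $\operatorname{dist}(x,A)=\min\{d(x,a):a\in A\}$; for $\varepsilon>0$ let $U_\varepsilon(A)=\{x\in Z:\operatorname{dist}(x,A)<\varepsilon\}$. For nonempty $X,Y\subseteq Z$, $d_H(X,Y)=\inf\{\varepsilon>0: X\subset U_\varepsilon(Y)\text{ and }Y\subset U_\varepsilon(X)\}$. Balls: $\mathbf{B}_Z$ is the set of all closed balls $B_r(c)=\{z\in Z:d(z,c)\le r\}$, $c\in Z$, $r\ge0$. For a ball $B$ with $|B|\ge2$, the diametrical graph $G_{D,B}$ has vertex set $B$, with $u,v$ adjacent iff $d(u,v)=\operatorname{diam}B$; it is known to be complete multipartite, $G_{D,B}=G_{D,B}[B_1,\dots,B_n]$ with parts $B_1,\dots,B_n$, $n\ge2$ (the classes of the equivalence relation $d(u,v)<\operatorname{diam}B$ on $B$), and these parts are balls of $Z$. The set $\mathfrak{B}_{XY}$: for subsets $X\ne Y$ of $Z$, $\mathfrak{B}_{XY}\subseteq\mathbf{B}_Z$ is the set of all balls $B$ in $Z$ having simultaneously the two properties: (i) ($(X\setminus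 Y)\cap B\ne\varnothing$ and $Y\cap B\ne\varnothing$) or ($(Y\setminus X)\cap B\ne\varnothing$ and $X\cap B\ne\varnothing$); (ii) if $G_{D,B}=G_{D,B}[B_1,\dots,B_n]$ is the diametrical graph of the subspace $B$, then there exists at least one $k\in\{1,\dots,n\}$ such that ($B_k\cap(X\setminus Y)\ne\varnothing$ and $B_k\cap Y=\varnothing$) xor ($B_k\cap(Y\setminus X)\ne\varnothing$ and $B_k\cap X=\varnothing$), where xor is exclusive disjunction. (Property (i) implies $|B|\ge2$, so (ii) makes sense for such $B$.) *)

theory Defs
  imports "HOL-Analysis.Abstract_Metric_Spaces" "HOL-Library.Disjoint_Sets"
begin

text \<open>A graph is given by a vertex set \<open>V\<close> and a set \<open>E\<close> of edges, each edge being the set of its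
  end points. The predicate below says that the graph is complete multipartite with set of
  (nonempty) parts \<open>P\<close>. Note that \<open>2 \<le> card P\<close> forces \<open>P\<close> to be finite.\<close>

definition complete_multipartite :: "'a set \<Rightarrow> 'a set set \<Rightarrow> 'a set set \<Rightarrow> bool" where
  "complete_multipartite V E P \<longleftrightarrow>
     partition_on V P \<and> 2 \<le> card P \<and>
     E = {{u, v} | u v. \<exists>C\<in>P. \<exists>D\<in>P. C \<noteq> D \<and> u \<in> C \<and> v \<in> D}"

lemma complete_multipartite_edge_iff:
  assumes cm: "complete_multipartite V E P" and "u \<in> V" "v \<in> V"
  shows "{u, v} \<in> E \<longleftrightarrow> \<not> (\<exists>C\<in>P. u \<in> C \<and> v \<in> C)"
proof -
  have part: "partition_on V P"
    and E: "E = {{u, v} | u v. \<exists>C\<in>P. \<exists>D\<in>P. C \<noteq> D \<and> u \<in> C \<and> v \<in> D}"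
    using cm unfolding complete_multipartite_def by blast+
  have uni: "C = D" if "C \<in> P" "D \<in> P" "w \<in> C" "w \<in> D" for C D w
    using disjointD[OF partition_onD2[OF part] that(1,2)] that(3,4) by blast
  obtain C D where CD: "C \<in> P" "u \<in> C" "D \<in> P" "v \<in> D"
    using assms(2,3) partition_onD1[OF part] by blast
  show ?thesis
  proof
    assume "{u, v} \<in> E"
    then obtain u' v' C' D' where *: "{u, v} = {u', v'}" "C' \<in> P" "D' \<in> P" "C' \<noteq> D'"
        "u' \<in> C'" "v' \<in> D'"
      unfolding E by blast
    from *(1) have "u = u' \<and> v = v' \<or> u = v' \<and> v = u'"
      by (simp only: doubleton_eq_iff)
    then show "\<not> (\<exists>C\<in>P. u \<in> C \<and> v \<in> C)"
      using * uni by metis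
  next
    assume "\<not> (\<exists>C\<in>P. u \<in> C \<and> v \<in> C)"
    then have "C \<noteq> D"
      using CD by blast
    then show "{u, v} \<in> E"
      unfolding E using CD by blast
  qed
qed

locale ultrametric_space = Metric_space Z d for Z :: "'a set" and d :: "'a \<Rightarrow> 'a \<Rightarrow> real" +
  assumes ultrametric:
    "\<lbrakk>x \<in> Z; y \<in> Z; z \<in> Z\<rbrakk> \<Longrightarrow> d x y \<le> max (d x z) (d z y)"
begin

text \<open>For finite nonempty \<open>A\<close> the infimum is the minimum, see \<open>dist_to_set_eq_Min\<close>.\<close>

definition dist_to_set :: "'a \<Rightarrow> 'a set \<Rightarrow> real" where
  "dist_to_set x A = (INF a\<in>A. d x a)"

definition nbhd :: "real \<Rightarrow> 'a set \<Rightarrow> 'a set" where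
  "nbhd e A = {x \<in> Z. dist_to_set x A < e}"

definition hausdorff_dist :: "'a set \<Rightarrow> 'a set \<Rightarrow> real" where
  "hausdorff_dist X Y = Inf {e. e > 0 \<and> X \<subseteq> nbhd e Y \<and> Y \<subseteq> nbhd e X}"

definition diam :: "'a set \<Rightarrow> real" where
  "diam A = (if A = {} then 0 else SUP (u, v)\<in>A \<times> A. d u v)"

definition balls :: "'a set set" where
  "balls = {mcball c r | c r. c \<in> Z \<and> 0 \<le> r}"

text \<open>The edges of the diametrical graph on \<open>B\<close>; intended for \<open>B\<close> with at least two points, so
  that \<open>diam B > 0\<close> and there are no loops.\<close>

definition diametrical_edges :: "'a set \<Rightarrow> 'a set set" where
  "diametrical_edges B = {{u, v} | u v. u \<in> B \<and> v \<in> B \<and> d u v = diam B}"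

text \<open>The parts of a complete multipartite graph are determined by the graph, and for a finite \<open>B\<close>
  with at least two points the diametrical graph is complete multipartite
  (see \<open>diametrical_parts_iff\<close>), so the existential quantifier over \<open>P\<close> just names the parts.
  The inequation between the two truth values is exclusive disjunction.\<close>

definition BXY :: "'a set \<Rightarrow> 'a set \<Rightarrow> 'a set set" where
  "BXY X Y = {B \<in> balls.
     (((X - Y) \<inter> B \<noteq> {} \<and> Y \<inter> B \<noteq> {}) \<or> ((Y - X) \<inter> B \<noteq> {} \<and> X \<inter> B \<noteq> {})) \<and>
     (\<exists>P. complete_multipartite B (diametrical_edges B) P \<and>
       (\<exists>C\<in>P. (C \<inter> (X - Y) \<noteq> {} \<and> C \<inter> Y = {}) \<noteq> (C \<inter> (Y - X) \<noteq> {} \<and> C \<inter> X = {})))}"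

lemma dist_to_set_eq_Min:
  assumes "finite A" "A \<noteq> {}"
  shows "dist_to_set x A = Min (d x ` A)"
  unfolding dist_to_set_def using assms by (simp add: cInf_eq_Min)

lemma diam_eq_Max:
  assumes "finite A" "A \<noteq> {}"
  shows "diam A = Max ((\<lambda>(u, v). d u v) ` (A \<times> A))"
  unfolding diam_def using assms by (simp add: cSup_eq_Max)

lemma finite_BXY: "finite Z \<Longrightarrow> finite (BXY X Y)"
proof -
  assume "finite Z"
  moreover have "BXY X Y \<subseteq> Pow Z"
    by (auto simp: BXY_def balls_def)
  ultimately show ?thesis
    by (meson finite_Pow_iff finite_subset)
qed

lemma dist_le_diam:
  assumes "finite B" "u \<in> B" "v \<in> B"
  shows "d u v \<le> diam B"
proof -
  have "d u v \<in> (\<lambda>(u, v). d u v) ` (B \<times> B)"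
    using assms by force
  moreover have "finite ((\<lambda>(u, v). d u v) ` (B \<times> B))"
    using assms by simp
  ultimately have "d u v \<le> Max ((\<lambda>(u, v). d u v) ` (B \<times> B))"
    by (rule Max_ge[rotated])
  moreover have "B \<noteq> {}"
    using assms(2) by blast
  ultimately show ?thesis
    using diam_eq_Max[OF assms(1)] by simp
qed

lemma diam_attained:
  assumes "finite B" "B \<noteq> {}"
  shows "\<exists>u\<in>B. \<exists>v\<in>B. d u v = diam B"
proof -
  have "Max ((\<lambda>(u, v). d u v) ` (B \<times> B)) \<in> (\<lambda>(u, v). d u v) ` (B \<times> B)"
    using assms by (intro Max_in) auto
  then have "diam B \<in> (\<lambda>(u, v). d u v) ` (B \<times> B)"
    by (simp only: diam_eq_Max[OF assms])
  then obtain p where p: "p \<in> B \<times> B" "diam B = (case p of (u, v) \<Rightarrow> d u v)"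
    by (rule imageE)
  obtain u v where "p = (u, v)"
    by (rule prod.exhaust)
  with p show ?thesis
    by (intro bexI[of _ u] bexI[of _ v]) simp_all
qed

lemma diam_pos:
  assumes "finite B" "B \<subseteq> Z" "2 \<le> card B"
  shows "0 < diam B"
proof -
  have "\<not> card B \<le> Suc 0"
    using assms(3) by simp
  then obtain u v where uv: "u \<in> B" "v \<in> B" "u \<noteq> v"
    using card_le_Suc0_iff_eq[OF assms(1)] by blast
  then have "u \<in> Z" "v \<in> Z"
    using assms(2) by blast+
  then have "0 < d u v"
    using uv(3) nonneg[of u v] zero[of u v] by linarith
  with dist_le_diam[OF assms(1) uv(1,2)] show ?thesis by linarith
qed

lemma equiv_less_diam:
  assumes "finite B" "B \<subseteq> Z" "2 \<le> card B"
  shows "equiv B {(u, v) \<in> B \<times> B. d u v < diam B}"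
proof (rule equivI)
  show "refl_on B {(u, v) \<in> B \<times> B. d u v < diam B}"
  proof (rule refl_onI)
    fix x assume x: "x \<in> B"
    then have "d x x = 0"
      using assms(2) zero by blast
    with x diam_pos[OF assms] show "(x, x) \<in> {(u, v) \<in> B \<times> B. d u v < diam B}" by simp
  qed
  show "sym {(u, v) \<in> B \<times> B. d u v < diam B}"
    by (rule symI) (clarsimp simp: commute)
  show "trans {(u, v) \<in> B \<times> B. d u v < diam B}"
  proof (rule transI, clarsimp)
    fix x y z assume *: "x \<in> B" "y \<in> B" "z \<in> B" "d x y < diam B" "d y z < diam B"
    have "d x z \<le> max (d x y) (d y z)"
      using * assms(2) by (intro ultrametric) blast+
    with * show "d x z < diam B" by linarith
  qed
qed blast

lemma diametrical_edges_iff: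
  assumes "u \<in> B" "v \<in> B"
  shows "{u, v} \<in> diametrical_edges B \<longleftrightarrow> d u v = diam B"
proof
  assume "{u, v} \<in> diametrical_edges B"
  then obtain u' v' where *: "{u, v} = {u', v'}" "d u' v' = diam B"
    unfolding diametrical_edges_def by blast
  from *(1) have "u = u' \<and> v = v' \<or> u = v' \<and> v = u'"
    by (simp only: doubleton_eq_iff)
  with *(2) show "d u v = diam B"
    by (metis commute)
next
  assume "d u v = diam B"
  with assms show "{u, v} \<in> diametrical_edges B"
    unfolding diametrical_edges_def by blast
qed

lemma diametrical_parts_unique:
  assumes B: "finite B"
    and cm: "complete_multipartite B (diametrical_edges B) P"
  shows "P = B // {(u, v) \<in> B \<times> B. d u v < diam B}"
proof -
  have part: "partition_on B P"
    using cm by (simp add: complete_multipartite_def)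
  have same: "d u v < diam B \<longleftrightarrow> (\<exists>C\<in>P. u \<in> C \<and> v \<in> C)" if "u \<in> B" "v \<in> B" for u v
    using complete_multipartite_edge_iff[OF cm that] diametrical_edges_iff[OF that]
      dist_le_diam[OF B that] by linarith
  have sub: "C \<subseteq> B" if "C \<in> P" for C
    using partition_onD1[OF part] that by blast
  have "{(x, y). \<exists>C\<in>P. x \<in> C \<and> y \<in> C} = {(u, v) \<in> B \<times> B. d u v < diam B}"
  proof (rule set_eqI, clarify)
    fix x y
    show "(x, y) \<in> {(x, y). \<exists>C\<in>P. x \<in> C \<and> y \<in> C} \<longleftrightarrow>
          (x, y) \<in> {(u, v) \<in> B \<times> B. d u v < diam B}"
      using same[of x y] sub by (cases "x \<in> B \<and> y \<in> B") auto
  qed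
  with partition_on_eq_quotient[OF part] show ?thesis by simp
qed

lemma diametrical_parts_exist:
  assumes "finite B" "B \<subseteq> Z" "2 \<le> card B"
  shows "complete_multipartite B (diametrical_edges B) (B // {(u, v) \<in> B \<times> B. d u v < diam B})"
proof -
  define R where "R = {(u, v) \<in> B \<times> B. d u v < diam B}"
  have eq: "equiv B R"
    unfolding R_def by (rule equiv_less_diam[OF assms])
  have part: "partition_on B (B // R)"
    by (rule partition_on_quotient[OF eq])
  have inP: "\<exists>C\<in>B // R. u \<in> C" if "u \<in> B" for u
    using partition_onD1[OF part] that by blast
  have sub: "C \<subseteq> B" if "C \<in> B // R" for C
    using partition_onD1[OF part] that by blast
  have rel: "C \<noteq> D \<longleftrightarrow> d u v = diam B" if "C \<in> B // R" "D \<in> B // R" "u \<in> C" "v \<in> D" for u v C D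
  proof -
    have uv: "u \<in> B" "v \<in> B"
      using that sub by blast+
    show ?thesis
      using quotient_eq_iff[OF eq that] uv dist_le_diam[OF assms(1) uv]
      by (simp add: R_def)
  qed
  have iff: "(u \<in> B \<and> v \<in> B \<and> d u v = diam B) \<longleftrightarrow>
        (\<exists>C\<in>B // R. \<exists>D\<in>B // R. C \<noteq> D \<and> u \<in> C \<and> v \<in> D)" for u v
  proof
    assume *: "u \<in> B \<and> v \<in> B \<and> d u v = diam B"
    then obtain C D where CD: "C \<in> B // R" "D \<in> B // R" "u \<in> C" "v \<in> D"
      using inP by meson
    with rel[OF CD] * show "\<exists>C\<in>B // R. \<exists>D\<in>B // R. C \<noteq> D \<and> u \<in> C \<and> v \<in> D"
      by blast
  next
    assume "\<exists>C\<in>B // R. \<exists>D\<in>B // R. C \<noteq> D \<and> u \<in> C \<and> v \<in> D"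
    then obtain C D where CD: "C \<in> B // R" "D \<in> B // R" "u \<in> C" "v \<in> D" "C \<noteq> D"
      by blast
    with rel[OF CD(1-4)] sub show "u \<in> B \<and> v \<in> B \<and> d u v = diam B"
      by blast
  qed
  have E: "diametrical_edges B =
      {{u, v} | u v. \<exists>C\<in>B // R. \<exists>D\<in>B // R. C \<noteq> D \<and> u \<in> C \<and> v \<in> D}"
    unfolding diametrical_edges_def by (simp only: iff)
  have "B \<noteq> {}"
    using assms(3) by auto
  then obtain u v where uv: "u \<in> B" "v \<in> B" "d u v = diam B"
    using diam_attained[OF assms(1)] by blast
  then obtain C D where CD: "C \<in> B // R" "D \<in> B // R" "C \<noteq> D"
    using iff by blast
  have "finite (B // R)"
    using finite_elements[OF assms(1) part] .
  then have "card {C, D} \<le> card (B // R)"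
    using CD by (intro card_mono) auto
  then have "2 \<le> card (B // R)"
    using CD(3) by simp
  then show ?thesis
    using part E by (simp add: complete_multipartite_def R_def)
qed

lemma diametrical_parts_iff:
  assumes "finite B" "B \<subseteq> Z" "2 \<le> card B"
  shows "complete_multipartite B (diametrical_edges B) P \<longleftrightarrow>
         P = B // {(u, v) \<in> B \<times> B. d u v < diam B}"
  using diametrical_parts_unique[OF assms(1)] diametrical_parts_exist[OF assms] by blast

end

end

theory Submission
  imports Defs
begin

text \<open>The proof rests on two observations. Since the sets are finite, the Hausdorff distance is the
  largest number among the distances from points of \<open>X\<close> to \<open>Y\<close> and from points of \<open>Y\<close> to \<open>X\<close>
  (\<open>hausdorff_dist_eq_Max\<close>). In an ultrametric space these numbers can be read off from balls, in
  both directions.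

  Let \<open>B \<in> BXY X Y\<close>. Then there is a part of the diametrical graph of \<open>B\<close> that contains a
  point of one of the two sets and misses the other set. The points of \<open>B\<close> outside that part lie at
  distance exactly \<open>diam B\<close> from it, and by the ultrametric inequality the points outside the ball
  are even further away. So \<open>diam B\<close> is at most the distance from that point to the other set, and
  hence at most the Hausdorff distance (\<open>diam_BXY_le_hausdorff_dist\<close>).

  Conversely, let \<open>x\<close> be in \<open>X\<close> but not in \<open>Y\<close>, and let \<open>r\<close> be its distance to \<open>Y\<close>. The closed
  ball of radius \<open>r\<close> about \<open>x\<close> contains a point of \<open>Y\<close> nearest to \<open>x\<close>, so it has diameter exactly
  \<open>r\<close>; its part around \<open>x\<close> is the open ball of radius \<open>r\<close>, which misses \<open>Y\<close>. So this ball
  belongs to \<open>BXY X Y\<close> (\<open>nearest_ball_in_BXY\<close>). For \<open>X \<noteq> Y\<close> the Hausdorff distance is attained at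
  such a point \<open>x\<close>, or at a point of \<open>Y\<close> outside \<open>X\<close>, and therefore is the diameter of a member of
  \<open>BXY X Y\<close>.\<close>

context ultrametric_space
begin

lemma dist_to_set_less_iff:
  assumes "finite A" "A \<noteq> {}"
  shows "dist_to_set x A < e \<longleftrightarrow> (\<exists>a\<in>A. d x a < e)"
  using assms by (simp add: dist_to_set_eq_Min Min_less_iff)

lemma le_dist_to_set_iff:
  assumes "finite A" "A \<noteq> {}"
  shows "e \<le> dist_to_set x A \<longleftrightarrow> (\<forall>a\<in>A. e \<le> d x a)"
  using assms by (simp add: dist_to_set_eq_Min Min_ge_iff)

lemma dist_to_set_attained:
  assumes "finite A" "A \<noteq> {}"
  obtains a where "a \<in> A" "d x a = dist_to_set x A"
proof -
  have "dist_to_set x A \<in> d x ` A"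
    unfolding dist_to_set_eq_Min[OF assms] using assms by (intro Min_in) auto
  then show thesis
    using that by fastforce
qed

lemma dist_to_set_nonneg: "finite A \<Longrightarrow> A \<noteq> {} \<Longrightarrow> 0 \<le> dist_to_set x A"
  by (simp add: le_dist_to_set_iff)

lemma dist_to_set_mem:
  assumes "finite A" "x \<in> A" "x \<in> Z"
  shows "dist_to_set x A = 0"
proof (rule antisym)
  have "A \<noteq> {}"
    using assms(2) by blast
  then show "0 \<le> dist_to_set x A"
    by (rule dist_to_set_nonneg[OF assms(1)])
  have "dist_to_set x A \<le> d x x"
    using le_dist_to_set_iff[OF assms(1) \<open>A \<noteq> {}\<close>] assms(2) by blast
  then show "dist_to_set x A \<le> 0"
    using assms(3) by simp
qed

lemma dist_to_set_pos:
  assumes "finite A" "A \<noteq> {}" "A \<subseteq> Z" "x \<in> Z" "x \<notin> A"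
  shows "0 < dist_to_set x A"
proof -
  obtain a where "a \<in> A" "d x a = dist_to_set x A"
    by (rule dist_to_set_attained[OF assms(1,2)])
  with assms show ?thesis
    by (metis mdist_pos_less subsetD)
qed

text \<open>The radii admitted in the definition of the Hausdorff distance are those exceeding each of
  the finitely many distances below, and such radii are automatically positive. They form an open
  ray, whose infimum is its end point.\<close>

lemma hausdorff_dist_eq_Max:
  assumes fin: "finite X" "finite Y" and sub: "X \<subseteq> Z" "Y \<subseteq> Z" and ne: "X \<noteq> {}" "Y \<noteq> {}"
  shows "hausdorff_dist X Y =
    Max ((\<lambda>x. dist_to_set x Y) ` X \<union> (\<lambda>y. dist_to_set y X) ` Y)" (is "_ = Max ?S")
proof -
  have S: "finite ?S" "?S \<noteq> {}"
    using fin ne by auto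
  have "0 \<le> Max ?S"
    using Max_in[OF S] dist_to_set_nonneg[OF fin(1) ne(1)] dist_to_set_nonneg[OF fin(2) ne(2)]
    by fastforce
  moreover have "X \<subseteq> nbhd e Y \<and> Y \<subseteq> nbhd e X \<longleftrightarrow> Max ?S < e" for e
    using sub by (auto simp: nbhd_def Max_less_iff[OF S])
  ultimately have "{e. e > 0 \<and> X \<subseteq> nbhd e Y \<and> Y \<subseteq> nbhd e X} = {Max ?S<..}"
    by auto
  then show ?thesis
    by (simp add: hausdorff_dist_def)
qed

lemma hausdorff_dist_commute: "hausdorff_dist X Y = hausdorff_dist Y X"
  unfolding hausdorff_dist_def by (rule arg_cong[where f = Inf]) blast

lemma BXY_commute: "BXY X Y = BXY Y X"
  unfolding BXY_def by (intro Collect_cong) (simp only: disj_commute neq_commute)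

lemma dist_to_set_le_hausdorff_dist:
  assumes "finite X" "finite Y" "X \<subseteq> Z" "Y \<subseteq> Z" "Y \<noteq> {}" "x \<in> X"
  shows "dist_to_set x Y \<le> hausdorff_dist X Y"
proof -
  have "X \<noteq> {}"
    using assms(6) by blast
  then show ?thesis
    using assms by (subst hausdorff_dist_eq_Max) auto
qed

lemma diam_mcball_le:
  assumes "finite Z" "c \<in> Z" "0 \<le> r"
  shows "diam (mcball c r) \<le> r"
proof -
  have "finite (mcball c r)"
    by (rule finite_subset[OF mcball_subset_mspace assms(1)])
  moreover have "mcball c r \<noteq> {}"
    using assms by auto
  ultimately obtain u v where uv: "u \<in> mcball c r" "v \<in> mcball c r" "d u v = diam (mcball c r)"
    using diam_attained by blast
  then have "d u v \<le> max (d u c) (d c v)"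
    by (intro ultrametric) auto
  with uv show ?thesis
    by (auto simp: commute)
qed

lemma diam_lt_dist_outside_ball:
  assumes "finite Z" "B \<in> balls" "x \<in> B" "y \<in> Z" "y \<notin> B"
  shows "diam B < d x y"
proof -
  obtain c r where B: "B = mcball c r" "c \<in> Z" "0 \<le> r"
    using assms(2) unfolding balls_def by blast
  have x: "x \<in> Z" "d c x \<le> r" and y: "r < d c y"
    using assms B by auto
  have "d c y \<le> max (d c x) (d x y)"
    using B x assms by (intro ultrametric)
  then have "r < d x y"
    using x y by linarith
  then show ?thesis
    unfolding B(1) using diam_mcball_le[OF assms(1) B(2,3)] by linarith
qed

text \<open>Inside the ball, points of different parts are joined by a diametrical edge; outside it,
  they are even further away.\<close>

lemma diam_le_dist_outside_part:
  assumes Z: "finite Z" and B: "B \<in> balls"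
    and cm: "complete_multipartite B (diametrical_edges B) P"
    and "C \<in> P" "x \<in> C" "y \<in> Z" "y \<notin> C"
  shows "diam B \<le> d x y"
proof (cases "y \<in> B")
  case True
  have part: "partition_on B P"
    using cm by (simp add: complete_multipartite_def)
  have "x \<in> B"
    using partition_onD1[OF part] assms by blast
  have "\<not> (\<exists>D\<in>P. x \<in> D \<and> y \<in> D)"
    using disjointD[OF partition_onD2[OF part]] assms by blast
  then have "{x, y} \<in> diametrical_edges B"
    using complete_multipartite_edge_iff[OF cm \<open>x \<in> B\<close> True] by blast
  then show ?thesis
    using diametrical_edges_iff[OF \<open>x \<in> B\<close> True] by simp
next
  case False
  have "x \<in> B"
    using cm assms by (auto simp: complete_multipartite_def partition_on_def)
  then show ?thesis
    using diam_lt_dist_outside_ball[OF Z B] assms False by fastforce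
qed

lemma diam_le_dist_to_set_if_part_disjoint:
  assumes "finite Z" "B \<in> balls" "complete_multipartite B (diametrical_edges B) P"
    and "C \<in> P" "x \<in> C" "A \<subseteq> Z" "A \<noteq> {}" "C \<inter> A = {}"
  shows "diam B \<le> dist_to_set x A"
proof -
  have "finite A"
    using assms finite_subset by blast
  moreover have "diam B \<le> d x a" if "a \<in> A" for a
    using diam_le_dist_outside_part[OF assms(1-5)] that assms by blast
  ultimately show ?thesis
    using assms(7) by (simp add: le_dist_to_set_iff)
qed

lemma diam_BXY_le_hausdorff_dist:
  assumes Z: "finite Z" and X: "X \<subseteq> Z" "X \<noteq> {}" and Y: "Y \<subseteq> Z" "Y \<noteq> {}"
    and B: "B \<in> BXY X Y"
  shows "diam B \<le> hausdorff_dist X Y"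
proof -
  have fin: "finite X" "finite Y"
    using Z X Y finite_subset by blast+
  obtain P C where P: "B \<in> balls" "complete_multipartite B (diametrical_edges B) P" "C \<in> P"
    and "(C \<inter> (X - Y) \<noteq> {} \<and> C \<inter> Y = {}) \<or> (C \<inter> (Y - X) \<noteq> {} \<and> C \<inter> X = {})"
    using B unfolding BXY_def by blast
  then consider x where "x \<in> C" "x \<in> X" "C \<inter> Y = {}" | y where "y \<in> C" "y \<in> Y" "C \<inter> X = {}"
    by blast
  then show ?thesis
  proof cases
    case 1
    have "diam B \<le> dist_to_set x Y"
      using diam_le_dist_to_set_if_part_disjoint[OF Z P 1(1) Y 1(3)] .
    also have "\<dots> \<le> hausdorff_dist X Y"
      using fin X Y 1 by (intro dist_to_set_le_hausdorff_dist)
    finally show ?thesis .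
  next
    case 2
    have "diam B \<le> dist_to_set y X"
      using diam_le_dist_to_set_if_part_disjoint[OF Z P 2(1) X 2(3)] .
    also have "\<dots> \<le> hausdorff_dist Y X"
      using fin X Y 2 by (intro dist_to_set_le_hausdorff_dist)
    finally show ?thesis
      by (simp only: hausdorff_dist_commute)
  qed
qed

lemma nearest_ball_in_BXY:
  assumes Z: "finite Z" and X: "X \<subseteq> Z" and Y: "Y \<subseteq> Z" "Y \<noteq> {}" and x: "x \<in> X" "x \<notin> Y"
  shows "\<exists>B\<in>BXY X Y. diam B = dist_to_set x Y"
proof -
  define r where "r = dist_to_set x Y"
  define B where "B = mcball x r"
  define C where "C = {(u, v) \<in> B \<times> B. d u v < diam B} `` {x}"
  have fin: "finite Y" "finite B"
    unfolding B_def using finite_subset[OF Y(1) Z] finite_subset[OF mcball_subset_mspace Z] .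
  have xZ: "x \<in> Z"
    using X x by blast
  have r: "0 < r"
    unfolding r_def using fin Y xZ x by (intro dist_to_set_pos)
  obtain y where y: "y \<in> Y" "d x y = r"
    using dist_to_set_attained[OF fin(1) Y(2)] unfolding r_def by blast
  have BZ: "B \<subseteq> Z" and xB: "x \<in> B" and yB: "y \<in> B"
    using Y(1) xZ r y by (auto simp: B_def)
  have diam: "diam B = r"
  proof (rule antisym)
    show "diam B \<le> r"
      unfolding B_def using Z xZ r by (intro diam_mcball_le) auto
    show "r \<le> diam B"
      using dist_le_diam[OF fin(2) xB yB] y by simp
  qed
  have "card {x, y} \<le> card B"
    using fin xB yB by (intro card_mono) auto
  then have "2 \<le> card B"
    using x y by (cases "x = y") auto
  then have cm: "complete_multipartite B (diametrical_edges B)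
      (B // {(u, v) \<in> B \<times> B. d u v < diam B})"
    by (rule diametrical_parts_exist[OF fin(2) BZ])
  have C: "C \<in> B // {(u, v) \<in> B \<times> B. d u v < diam B}"
    unfolding C_def by (rule quotientI[OF xB])
  have xC: "x \<in> C"
    using xB xZ r by (simp add: C_def diam)
  \<comment> \<open>The part of \<open>x\<close> consists of points at distance less than \<open>r\<close> from \<open>x\<close>, and \<open>Y\<close> has none.\<close>
  have "\<forall>a\<in>Y. r \<le> d x a"
    using le_dist_to_set_iff[OF fin(1) Y(2)] unfolding r_def by blast
  then have CY: "C \<inter> Y = {}"
    by (fastforce simp: C_def diam)
  have "B \<in> balls"
    unfolding balls_def B_def using xZ less_imp_le[OF r] by blast
  moreover have "((X - Y) \<inter> B \<noteq> {} \<and> Y \<inter> B \<noteq> {}) \<or> ((Y - X) \<inter> B \<noteq> {} \<and> X \<inter> B \<noteq> {})"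
    using x xB y yB by blast
  moreover have "(C \<inter> (X - Y) \<noteq> {} \<and> C \<inter> Y = {}) \<noteq> (C \<inter> (Y - X) \<noteq> {} \<and> C \<inter> X = {})"
    using x xC CY by blast
  ultimately have "B \<in> BXY X Y"
    unfolding BXY_def using cm C by (intro CollectI conjI exI bexI)
  then show ?thesis
    using diam unfolding r_def by (rule bexI[rotated])
qed

text \<open>The Hausdorff distance of different sets is positive, so it is not attained at a common
  point of \<open>X\<close> and \<open>Y\<close>, whose distance to either set is \<open>0\<close>; at any other point
  \<open>nearest_ball_in_BXY\<close> applies.\<close>

lemma hausdorff_dist_attained_in_BXY:
  assumes Z: "finite Z" and X: "X \<subseteq> Z" "X \<noteq> {}" and Y: "Y \<subseteq> Z" "Y \<noteq> {}" and ne: "X \<noteq> Y"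
  shows "hausdorff_dist X Y \<in> diam ` BXY X Y"
proof -
  have fin: "finite X" "finite Y"
    using Z X Y finite_subset by blast+
  have pos: "0 < hausdorff_dist X Y"
  proof -
    consider x where "x \<in> X" "x \<notin> Y" | y where "y \<in> Y" "y \<notin> X"
      using ne by blast
    then show ?thesis
    proof cases
      case 1
      then show ?thesis
        using dist_to_set_pos[of Y x] dist_to_set_le_hausdorff_dist[of X Y x] fin X Y by fastforce
    next
      case 2
      then show ?thesis
        using dist_to_set_pos[of X y] dist_to_set_le_hausdorff_dist[of Y X y] fin X Y
          hausdorff_dist_commute[of X Y] by fastforce
    qed
  qed
  have "hausdorff_dist X Y \<in> (\<lambda>x. dist_to_set x Y) ` X \<union> (\<lambda>y. dist_to_set y X) ` Y"
    unfolding hausdorff_dist_eq_Max[OF fin X(1) Y(1) X(2) Y(2)]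
    using fin X Y by (intro Max_in) auto
  then consider x where "x \<in> X" "hausdorff_dist X Y = dist_to_set x Y"
    | y where "y \<in> Y" "hausdorff_dist X Y = dist_to_set y X"
    by blast
  then show ?thesis
  proof cases
    case 1
    then have "x \<notin> Y"
      using pos dist_to_set_mem[OF fin(2), of x] X by auto
    then show ?thesis
      using nearest_ball_in_BXY[OF Z X(1) Y 1(1)] 1 by force
  next
    case 2
    then have "y \<notin> X"
      using pos dist_to_set_mem[OF fin(1), of y] Y by auto
    then show ?thesis
      using nearest_ball_in_BXY[OF Z Y(1) X 2(1)] 2 BXY_commute[of X Y] by force
  qed
qed

lemma hausdorff_dist_self:
  assumes "finite X" "X \<subseteq> Z" "X \<noteq> {}"
  shows "hausdorff_dist X X = 0"
proof -
  have "(\<lambda>x. dist_to_set x X) ` X = {0}"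
    using dist_to_set_mem[OF assms(1)] assms by force
  then show ?thesis
    using assms by (simp add: hausdorff_dist_eq_Max)
qed

end

theorem theorem4p4:
  fixes Z :: "'a set" and d :: "'a \<Rightarrow> 'a \<Rightarrow> real" and X Y :: "'a set"
  assumes "ultrametric_space Z d"
    and "finite Z"
    and "X \<subseteq> Z" and "X \<noteq> {}"
    and "Y \<subseteq> Z" and "Y \<noteq> {}"
  shows "(X \<noteq> Y \<longrightarrow> ultrametric_space.BXY Z d X Y \<noteq> {}) \<and>
    ultrametric_space.hausdorff_dist Z d X Y =
      (if X = Y then 0
       else Max (ultrametric_space.diam d ` ultrametric_space.BXY Z d X Y))"
proof -
  interpret ultrametric_space Z d
    by (rule assms(1))
  show ?thesis
  proof (cases "X = Y")
    case True
    then show ?thesis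
      using hausdorff_dist_self finite_subset assms by auto
  next
    case False
    have att: "hausdorff_dist X Y \<in> diam ` BXY X Y"
      using hausdorff_dist_attained_in_BXY assms(2-6) False by blast
    have "Max (diam ` BXY X Y) = hausdorff_dist X Y"
    proof (rule Max_eqI)
      show "finite (diam ` BXY X Y)"
        using finite_BXY assms(2) by blast
      show "r \<le> hausdorff_dist X Y" if "r \<in> diam ` BXY X Y" for r
        using diam_BXY_le_hausdorff_dist[OF assms(2-6)] that by blast
    qed (rule att)
    then show ?thesis
      using False att by auto
  qed
qed

end
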